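(* Let $\Phi:\mathbb{M}(n)\to\mathbb{M}(k)$ be a positive unital linear map. Let $A\in\mathbb{M}(n)$ be a Hermitian matrix whose spectrum is contained in the real interval $[m,M]$. If $A$ is positive definite, then for every $r=0,1,2,\ldots$, $$\left[\Phi\left(A^{i+j-3}(A-mI)(MI-A)\right)\right]_{1\le i,j\le r+1}\ge O.$$
   Context: $\mathbb{M}(n)$ is the $C^*$-algebra of all $n\times n$ complex matrices. A linear map $\Phi:\mathbb{M}(n)\to\mathbb{M}(k)$ is positive if it sends positive semidefinite matrices to positive semidefinite matrices, and unital if $\Phi(I)=I$. $[X_{ij}]_{1\le i,j\le r+1}$ with $X_{ij}\in\mathbb{M}(k)$ denotes the $(r+1)\times(r+1)$ block matrix with blocks $X_{ij}$, viewed as an element of $\mathbb{M}((r+1)k)$. $X\ge O$ means $X$ is Hermitian positive semidefinite. $A^0=I$ and $A^{-1}$ is the inverse of $A$. *)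

theory Defs
  imports
    "Jordan_Normal_Form.Spectral_Radius"
    "Jordan_Normal_Form.Schur_Decomposition"
    "Jordan_Normal_Form.Gauss_Jordan_Elimination"
    "Jordan_Normal_Form.VS_Connect"
begin

text \<open>The equation forces \<open>A\<close> to be square, as \<open>mat_adjoint\<close> swaps the dimensions.\<close>

definition hermitian :: "complex mat \<Rightarrow> bool" where
  "hermitian A \<longleftrightarrow> mat_adjoint A = A"

text \<open>\<open>(A *\<^sub>v v) \<bullet>c v\<close> is \<open>v\<^sup>* A v\<close>. The order on \<open>complex\<close> is that of \<open>Complex_Order\<close>:
  \<open>0 \<le> z\<close> says that \<open>z\<close> is real and nonnegative.\<close>

definition positive_semidefinite :: "complex mat \<Rightarrow> bool" where
  "positive_semidefinite A \<longleftrightarrow>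
     hermitian A \<and> (\<forall>v \<in> carrier_vec (dim_row A). 0 \<le> (A *\<^sub>v v) \<bullet>c v)"

definition positive_definite :: "complex mat \<Rightarrow> bool" where
  "positive_definite A \<longleftrightarrow>
     hermitian A \<and>
     (\<forall>v \<in> carrier_vec (dim_row A). v \<noteq> 0\<^sub>v (dim_row A) \<longrightarrow> 0 < (A *\<^sub>v v) \<bullet>c v)"

text \<open>Matrices of all sizes share the type \<open>complex mat\<close>, so a map from \<open>n \<times> n\<close> to \<open>k \<times> k\<close>
  matrices is a total function on that type of which only the values on \<open>carrier_mat n n\<close> matter.\<close>

definition mat_linear_map :: "nat \<Rightarrow> nat \<Rightarrow> (complex mat \<Rightarrow> complex mat) \<Rightarrow> bool" where
  "mat_linear_map n k \<Phi> \<longleftrightarrow>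
     linear_map class_ring (module_mat TYPE(complex) n n) (module_mat TYPE(complex) k k) \<Phi>"

definition positive_map :: "nat \<Rightarrow> (complex mat \<Rightarrow> complex mat) \<Rightarrow> bool" where
  "positive_map n \<Phi> \<longleftrightarrow>
     (\<forall>X \<in> carrier_mat n n. positive_semidefinite X \<longrightarrow> positive_semidefinite (\<Phi> X))"

definition unital_map :: "nat \<Rightarrow> nat \<Rightarrow> (complex mat \<Rightarrow> complex mat) \<Rightarrow> bool" where
  "unital_map n k \<Phi> \<longleftrightarrow> \<Phi> (1\<^sub>m n) = 1\<^sub>m k"

text \<open>Integer powers; for a negative exponent this is meaningful only if \<open>A\<close> is invertible,
  since \<open>mat_inverse A = None\<close> otherwise.\<close>

definition mat_powi :: "complex mat \<Rightarrow> int \<Rightarrow> complex mat" where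
  "mat_powi A e =
     (if 0 \<le> e then A ^\<^sub>m nat e else the (mat_inverse A) ^\<^sub>m nat (- e))"

text \<open>The \<open>p \<times> p\<close> block matrix with \<open>k \<times> k\<close> blocks \<open>X i j\<close>. Blocks are numbered from \<open>1\<close> to \<open>p\<close>,
  whereas the entries of a \<open>mat\<close> are numbered from \<open>0\<close>.\<close>

definition block_matrix :: "nat \<Rightarrow> nat \<Rightarrow> (nat \<Rightarrow> nat \<Rightarrow> complex mat) \<Rightarrow> complex mat" where
  "block_matrix p k X =
     mat (p * k) (p * k)
       (\<lambda>(a, b). X (a div k + 1) (b div k + 1) $$ (a mod k, b mod k))"

end

theory Submission
  imports Defs
begin

text \<open>Decompose \<open>I = \<Sum>\<^sub>s E\<^sub>s\<close> with positive semidefinite \<open>E\<^sub>s\<close> and \<open>A E\<^sub>s = \<lambda>\<^sub>s E\<^sub>s\<close>. By linearity the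
  block matrix is \<open>\<Sum>\<^sub>s c\<^sub>s [\<lambda>\<^sub>s\<^sup>i\<^sup>-\<^sup>1 \<lambda>\<^sub>s\<^sup>j\<^sup>-\<^sup>1 \<Phi>(E\<^sub>s)]\<^sub>i\<^sub>j\<close> with
  \<open>c\<^sub>s = (\<lambda>\<^sub>s - m)(M - \<lambda>\<^sub>s) / \<lambda>\<^sub>s \<ge> 0\<close>, and each summand is a congruence transform of \<open>\<Phi>(E\<^sub>s) \<ge> O\<close>.\<close>

section \<open>Hermitian matrices and the inner product in coordinates\<close>

lemma mat_adjoint_eq:
  fixes A :: "complex mat"
  assumes "A \<in> carrier_mat n m"
  shows "mat_adjoint A = mat m n (\<lambda>(i, j). cnj (A $$ (j, i)))"
  using assms by (intro eq_matI) (auto simp: mat_adjoint_def mat_of_rows_def)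

lemma hermitianI:
  assumes A: "A \<in> carrier_mat n n"
    and "\<And>i j. i < n \<Longrightarrow> j < n \<Longrightarrow> cnj (A $$ (j, i)) = A $$ (i, j)"
  shows "hermitian A"
  unfolding hermitian_def mat_adjoint_eq[OF A] using assms by (intro eq_matI) auto

lemma hermitianD:
  assumes "hermitian A" "A \<in> carrier_mat n n" "i < n" "j < n"
  shows "cnj (A $$ (j, i)) = A $$ (i, j)"
proof -
  have "cnj (A $$ (j, i)) = mat_adjoint A $$ (i, j)"
    using assms(3,4) by (simp add: mat_adjoint_eq[OF assms(2)])
  with assms(1) show ?thesis by (simp add: hermitian_def)
qed

lemma inner_eq_sum:
  assumes "u \<in> carrier_vec n" "v \<in> carrier_vec n"
  shows "u \<bullet>c v = (\<Sum>i<n. u $ i * cnj (v $ i))"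
  using assms by (auto simp: scalar_prod_def lessThan_atLeast0)

lemma inner_commute:
  assumes "u \<in> carrier_vec n" "v \<in> carrier_vec n"
  shows "u \<bullet>c v = cnj (v \<bullet>c u)"
  using assms by (auto simp: inner_eq_sum[of _ n] mult.commute)

lemma mult_mat_vec_index_sum:
  assumes "A \<in> carrier_mat n m" "v \<in> carrier_vec m" "i < n"
  shows "(A *\<^sub>v v) $ i = (\<Sum>j<m. A $$ (i, j) * v $ j)"
  using assms by (auto simp: scalar_prod_def lessThan_atLeast0)

text \<open>Exchanging the two sums of the form moves \<open>A\<close> to the other argument, since
  its entries are conjugate-symmetric.\<close>

lemma hermitian_inner:
  assumes A: "A \<in> carrier_mat n n" "hermitian A"
    and u: "u \<in> carrier_vec n" and v: "v \<in> carrier_vec n"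
  shows "(A *\<^sub>v u) \<bullet>c v = u \<bullet>c (A *\<^sub>v v)"
proof -
  have "(A *\<^sub>v u) \<bullet>c v = (\<Sum>i<n. \<Sum>j<n. A $$ (i, j) * u $ j * cnj (v $ i))"
    using A u v by (simp add: inner_eq_sum[of _ n] mult_mat_vec_index_sum[of A n n] sum_distrib_right
        del: index_mult_mat_vec)
  also have "\<dots> = (\<Sum>j<n. \<Sum>i<n. A $$ (i, j) * u $ j * cnj (v $ i))"
    by (rule sum.swap)
  also have "\<dots> = (\<Sum>j<n. \<Sum>i<n. u $ j * cnj (A $$ (j, i) * v $ i))"
    using A by (intro sum.cong refl) (auto simp: hermitianD[of A n] mult_ac)
  also have "\<dots> = u \<bullet>c (A *\<^sub>v v)"
    using A u v by (simp add: inner_eq_sum[of _ n] mult_mat_vec_index_sum[of A n n] sum_distrib_left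
        del: index_mult_mat_vec)
  finally show ?thesis .
qed

text \<open>The order forces both numbers to be real. The case \<open>b = 0\<close> is covered
  because division by zero gives \<open>0\<close>; this is the case of the projection onto the zero
  vector.\<close>

lemma complex_divide_nonneg:
  fixes a b :: complex
  assumes "0 \<le> a" "0 \<le> b"
  shows "0 \<le> a / b"
proof -
  have "a = complex_of_real (Re a)" "b = complex_of_real (Re b)" "0 \<le> Re a" "0 \<le> Re b"
    using assms by (auto simp: less_eq_complex_def complex_eq_iff)
  then have "a / b = complex_of_real (Re a / Re b)" "0 \<le> Re a / Re b"
    by (metis of_real_divide, simp)
  then show ?thesis by (simp add: less_eq_complex_def)
qed

section \<open>The cone of positive semidefinite matrices\<close>

lemma positive_semidefinite_add:
  assumes "A \<in> carrier_mat n n" "B \<in> carrier_mat n n"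
    and "positive_semidefinite A" "positive_semidefinite B"
  shows "positive_semidefinite (A + B)"
proof -
  have "hermitian (A + B)"
    using assms
    by (intro hermitianI[of _ n]) (auto simp: positive_semidefinite_def hermitianD[of _ n])
  moreover have "0 \<le> ((A + B) *\<^sub>v v) \<bullet>c v" if "v \<in> carrier_vec n" for v
  proof -
    have "((A + B) *\<^sub>v v) \<bullet>c v = (A *\<^sub>v v) \<bullet>c v + (B *\<^sub>v v) \<bullet>c v"
      using assms that
      by (subst add_mult_distrib_mat_vec[of _ n n]) (auto intro!: add_scalar_prod_distrib[of _ n])
    then show ?thesis
      using assms that by (auto simp: positive_semidefinite_def intro!: add_nonneg_nonneg)
  qed
  ultimately show ?thesis
    using assms by (auto simp: positive_semidefinite_def)
qed

lemma positive_semidefinite_smult: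
  assumes "A \<in> carrier_mat n n" "positive_semidefinite A" "0 \<le> c"
  shows "positive_semidefinite (complex_of_real c \<cdot>\<^sub>m A)"
proof -
  have "hermitian (complex_of_real c \<cdot>\<^sub>m A)"
    using assms
    by (intro hermitianI[of _ n]) (auto simp: positive_semidefinite_def hermitianD[of _ n])
  moreover have "0 \<le> ((complex_of_real c \<cdot>\<^sub>m A) *\<^sub>v v) \<bullet>c v" if v: "v \<in> carrier_vec n" for v
  proof -
    have "(complex_of_real c \<cdot>\<^sub>m A) *\<^sub>v v = complex_of_real c \<cdot>\<^sub>v (A *\<^sub>v v)"
      using assms v by (intro eq_vecI) auto
    then have "((complex_of_real c \<cdot>\<^sub>m A) *\<^sub>v v) \<bullet>c v = complex_of_real c * ((A *\<^sub>v v) \<bullet>c v)"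
      using assms v by (auto intro!: smult_scalar_prod_distrib[of _ n])
    moreover have "0 \<le> (A *\<^sub>v v) \<bullet>c v" "0 \<le> complex_of_real c"
      using assms v by (auto simp: positive_semidefinite_def less_eq_complex_def)
    ultimately show ?thesis
      by (metis mult_nonneg_nonneg)
  qed
  ultimately show ?thesis
    using assms by (auto simp: positive_semidefinite_def)
qed

lemma positive_semidefinite_zero: "positive_semidefinite (0\<^sub>m n n)"
proof -
  have "(0\<^sub>m n n *\<^sub>v v) \<bullet>c v = 0" if v: "v \<in> carrier_vec n" for v :: "complex vec"
  proof -
    have "0\<^sub>m n n *\<^sub>v v = 0\<^sub>v n"
    proof (rule eq_vecI)
      fix i assume "i < dim_vec (0\<^sub>v n :: complex vec)"
      then have i: "i < n" by simp
      show "(0\<^sub>m n n *\<^sub>v v) $ i = 0\<^sub>v n $ i"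
        unfolding mult_mat_vec_index_sum[OF zero_carrier_mat v i] using i by simp
    qed simp
    then show ?thesis using v by simp
  qed
  moreover have "hermitian (0\<^sub>m n n)"
    by (rule hermitianI[of _ n]) simp_all
  ultimately show ?thesis
    by (simp add: positive_semidefinite_def)
qed

section \<open>Finite sums of square matrices\<close>

text \<open>Matrices of all sizes share one type, so the size \<open>n\<close> is an argument: it
  fixes which zero matrix is the empty sum.\<close>

primrec mat_sum :: "nat \<Rightarrow> (nat \<Rightarrow> complex mat) \<Rightarrow> nat \<Rightarrow> complex mat" where
  "mat_sum n E 0 = 0\<^sub>m n n"
| "mat_sum n E (Suc t) = mat_sum n E t + E t"

lemma mat_sum_carrier:
  assumes "\<And>i. i < t \<Longrightarrow> E i \<in> carrier_mat n n"
  shows "mat_sum n E t \<in> carrier_mat n n"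
  using assms by (induction t) auto

lemma mat_sum_cong:
  assumes "\<And>i. i < t \<Longrightarrow> E i = F i"
  shows "mat_sum n E t = mat_sum n F t"
  using assms by (induction t) auto

lemma mat_sum_index:
  assumes "\<And>i. i < t \<Longrightarrow> E i \<in> carrier_mat n n" "a < n" "b < n"
  shows "mat_sum n E t $$ (a, b) = (\<Sum>i<t. E i $$ (a, b))"
  using assms
proof (induction t)
  case (Suc t)
  have "dim_row (E t) = n" "dim_col (E t) = n"
    using Suc.prems(1)[of t] by auto
  with Suc show ?case by simp
qed simp

lemma mult_mat_sum:
  assumes "X \<in> carrier_mat n n" "\<And>i. i < t \<Longrightarrow> E i \<in> carrier_mat n n"
  shows "X * mat_sum n E t = mat_sum n (\<lambda>i. X * E i) t"
  using assms
proof (induction t)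
  case (Suc t)
  then have "X * (mat_sum n E t + E t) = X * mat_sum n E t + X * E t"
    by (intro mult_add_distrib_mat[of _ n n]) (auto intro: mat_sum_carrier)
  with Suc show ?case by simp
qed auto

lemma positive_semidefinite_mat_sum:
  assumes "\<And>i. i < t \<Longrightarrow> E i \<in> carrier_mat n n" "\<And>i. i < t \<Longrightarrow> positive_semidefinite (E i)"
  shows "positive_semidefinite (mat_sum n E t)"
  using assms
  by (induction t) (auto intro!: positive_semidefinite_zero positive_semidefinite_add[of _ n] mat_sum_carrier)

section \<open>Orthogonal projections onto lines\<close>

text \<open>For \<open>w = 0\<close> the division by zero makes this the zero matrix, which still is the orthogonal
  projection onto the span of \<open>w\<close>.\<close>

definition projection :: "complex vec \<Rightarrow> complex mat" where
  "projection w = mat (dim_vec w) (dim_vec w) (\<lambda>(i, j). w $ i * cnj (w $ j) / (w \<bullet>c w))"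

lemma projection_carrier: "w \<in> carrier_vec n \<Longrightarrow> projection w \<in> carrier_mat n n"
  by (auto simp: projection_def)

lemma projection_mult_vec:
  assumes "w \<in> carrier_vec n" "v \<in> carrier_vec n"
  shows "projection w *\<^sub>v v = ((v \<bullet>c w) / (w \<bullet>c w)) \<cdot>\<^sub>v w"
proof (rule eq_vecI)
  fix i assume "i < dim_vec (((v \<bullet>c w) / (w \<bullet>c w)) \<cdot>\<^sub>v w)"
  then have i: "i < n" using assms by auto
  have "(projection w *\<^sub>v v) $ i = (\<Sum>j<n. w $ i * cnj (w $ j) / (w \<bullet>c w) * v $ j)"
    using assms i by (simp add: mult_mat_vec_index_sum[OF projection_carrier] del: index_mult_mat_vec)
     (simp add: projection_def)
  also have "\<dots> = (v \<bullet>c w) / (w \<bullet>c w) * w $ i"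
    unfolding inner_eq_sum[OF assms(2,1)] sum_divide_distrib sum_distrib_right
    by (simp add: mult_ac)
  finally show "(projection w *\<^sub>v v) $ i = (((v \<bullet>c w) / (w \<bullet>c w)) \<cdot>\<^sub>v w) $ i"
    using assms i by simp
qed (use assms in \<open>auto simp: projection_def\<close>)

text \<open>The quadratic form at \<open>v\<close> is the squared modulus of
  \<open>v \<bullet>c w\<close> divided by \<open>w \<bullet>c w\<close>.\<close>

lemma positive_semidefinite_projection:
  assumes w: "w \<in> carrier_vec n"
  shows "positive_semidefinite (projection w)"
proof -
  have "cnj (w \<bullet>c w) = w \<bullet>c w"
    using inner_commute[OF w w] by metis
  then have "hermitian (projection w)"
    using w by (intro hermitianI[of _ n]) (auto simp: projection_def)
  moreover have "0 \<le> (projection w *\<^sub>v v) \<bullet>c v" if v: "v \<in> carrier_vec n" for v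
  proof -
    have "(projection w *\<^sub>v v) \<bullet>c v = ((v \<bullet>c w) / (w \<bullet>c w)) * (w \<bullet>c v)"
      using w v by (auto simp: projection_mult_vec[OF w v] intro!: smult_scalar_prod_distrib[of _ n])
    also have "\<dots> = ((v \<bullet>c w) * cnj (v \<bullet>c w)) / (w \<bullet>c w)"
      by (subst inner_commute[OF w v]) simp
    also have "0 \<le> \<dots>"
      using conjugate_square_ge_0_vec[of w] conjugate_square_positive[of "v \<bullet>c w"] 
      by (intro complex_divide_nonneg) auto
    finally show ?thesis .
  qed
  ultimately show ?thesis
    using projection_carrier[OF w] by (auto simp: positive_semidefinite_def)
qed

text \<open>Unit vectors extract the columns.\<close>

lemma mat_eq_if_mult_vec_eq:
  fixes A B :: "complex mat"
  assumes A: "A \<in> carrier_mat n m" and B: "B \<in> carrier_mat n m"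
    and "\<And>v. v \<in> carrier_vec m \<Longrightarrow> A *\<^sub>v v = B *\<^sub>v v"
  shows "A = B"
proof (rule mat_col_eqI)
  have col_unit: "C *\<^sub>v unit_vec m j = col C j" if "C \<in> carrier_mat n m" "j < m"
    for C :: "complex mat" and j
    using that by (intro eq_vecI) auto
  fix j assume "j < dim_col B"
  then have "j < m" using B by auto
  then have "A *\<^sub>v unit_vec m j = B *\<^sub>v unit_vec m j" using assms(3) by auto
  then show "col A j = col B j"
    using col_unit[OF A] col_unit[OF B] \<open>j < m\<close> by simp
qed (use A B in auto)

text \<open>Every vector in the range of \<open>projection w\<close> is a multiple of
  \<open>w\<close>, on which \<open>A\<close> acts as \<open>l\<close>. Below, the lemma serves for
  \<open>A\<close> itself, for a complementary projection with \<open>l = 0\<close>, and for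
  \<open>projection w\<close> with \<open>l = 1\<close>.\<close>

lemma mult_projection_eigenvector:
  assumes A: "A \<in> carrier_mat n n" and w: "w \<in> carrier_vec n" and ev: "A *\<^sub>v w = l \<cdot>\<^sub>v w"
  shows "A * projection w = l \<cdot>\<^sub>m projection w"
proof (rule mat_eq_if_mult_vec_eq[of _ n n])
  fix v :: "complex vec" assume v: "v \<in> carrier_vec n"
  have "(l \<cdot>\<^sub>m projection w) *\<^sub>v v = l \<cdot>\<^sub>v (projection w *\<^sub>v v)"
    using projection_carrier[OF w] v by (intro eq_vecI) auto
  then show "(A * projection w) *\<^sub>v v = (l \<cdot>\<^sub>m projection w) *\<^sub>v v"
    using A w v projection_carrier[OF w]
    by (simp add: projection_mult_vec mult_mat_vec ev smult_smult_assoc mult.commute)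
qed (use A projection_carrier[OF w] in auto)

text \<open>At an eigenvector \<open>v\<close> the form equals its own conjugate by
  \<open>hermitian_inner\<close>; the two sides are \<open>l\<close> and \<open>cnj l\<close> times
  the nonzero number \<open>v \<bullet>c v\<close>.\<close>

lemma hermitian_eigenvalue_real:
  assumes A: "A \<in> carrier_mat n n" "hermitian A" and l: "eigenvalue A l"
  shows "cnj l = l"
proof -
  obtain v where v: "v \<in> carrier_vec n" "v \<noteq> 0\<^sub>v n" and ev: "A *\<^sub>v v = l \<cdot>\<^sub>v v"
    using l A(1) by (auto simp: eigenvalue_def eigenvector_def)
  have "l * (v \<bullet>c v) = (A *\<^sub>v v) \<bullet>c v"
    using v unfolding ev by (auto intro!: smult_scalar_prod_distrib[symmetric, of _ n])
  also have "\<dots> = cnj ((A *\<^sub>v v) \<bullet>c v)"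
    using A v hermitian_inner[OF A v(1) v(1)] inner_commute[of "A *\<^sub>v v" n v]
    by (metis carrier_matD(1) carrier_vecI complex_cnj_cnj dim_mult_mat_vec inner_commute)
  also have "\<dots> = cnj l * (v \<bullet>c v)"
  proof -
    have "(A *\<^sub>v v) \<bullet>c v = l * (v \<bullet>c v)"
      using v unfolding ev by (auto intro!: smult_scalar_prod_distrib[of _ n])
    then show ?thesis using inner_commute[OF v(1) v(1)] by simp
  qed
  finally show ?thesis using v by simp
qed

text \<open>Together with \<open>mult_projection_eigenvector\<close> for \<open>l = 1\<close> this
  makes the projection idempotent. If \<open>w = 0\<close>, both sides vanish.\<close>

lemma projection_idem:
  assumes w: "w \<in> carrier_vec n"
  shows "projection w *\<^sub>v w = w"
proof (cases "w = 0\<^sub>v n")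
  case False
  then have "w \<bullet>c w \<noteq> 0" using w by simp
  then show ?thesis by (simp add: projection_mult_vec[OF w w])
next
  case True
  then show ?thesis
    unfolding projection_mult_vec[OF w w] by (intro eq_vecI) auto
qed

section \<open>The spectral resolution of a Hermitian matrix\<close>

text \<open>The adjoint of \<open>X * Y\<close> is \<open>Y * X\<close>; the computation is carried
  out entrywise.\<close>

lemma hermitian_mult_commute:
  assumes X: "X \<in> carrier_mat n n" "hermitian X" and Y: "Y \<in> carrier_mat n n" "hermitian Y"
    and XY: "hermitian (X * Y)"
  shows "Y * X = X * Y"
proof (rule eq_matI)
  fix i j assume "i < dim_row (X * Y)" "j < dim_col (X * Y)"
  then have ij: "i < n" "j < n" using X Y by auto
  have prod: "(U * V) $$ (a, b) = (\<Sum>k<n. U $$ (a, k) * V $$ (k, b))"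
    if "U \<in> carrier_mat n n" "V \<in> carrier_mat n n" "a < n" "b < n" for U V :: "complex mat" and a b
    using that by (auto simp: scalar_prod_def lessThan_atLeast0)
  have "(Y * X) $$ (i, j) = (\<Sum>k<n. Y $$ (i, k) * X $$ (k, j))"
    by (rule prod[OF Y(1) X(1) ij])
  also have "\<dots> = (\<Sum>k<n. cnj (X $$ (j, k) * Y $$ (k, i)))"
    using ij X Y by (intro sum.cong refl) (auto simp: hermitianD[of _ n])
  also have "\<dots> = cnj ((X * Y) $$ (j, i))"
    by (simp only: prod[OF X(1) Y(1) ij(2,1)] cnj_sum)
  also have "\<dots> = (X * Y) $$ (i, j)"
    using hermitianD[OF XY _ ij] X Y by auto
  finally show "(Y * X) $$ (i, j) = (X * Y) $$ (i, j)" .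
qed (use X Y in auto)

text \<open>Over the complex numbers the characteristic polynomial splits, so a Schur decomposition
  exists. Its diagonal lists the roots of that polynomial, and \<open>A * P = P * B\<close> says
  that \<open>A\<close> maps each column of \<open>P\<close> into the span of that column and the
  earlier ones.\<close>

lemma complex_schur_triangularization:
  fixes A :: "complex mat"
  assumes A: "A \<in> carrier_mat n n"
  obtains B P Q where "B \<in> carrier_mat n n" "P \<in> carrier_mat n n" "Q \<in> carrier_mat n n"
    "P * Q = 1\<^sub>m n" "A * P = P * B" "upper_triangular B"
    "\<And>i. i < n \<Longrightarrow> eigenvalue A (B $$ (i, i))"
proof -
  obtain es where es: "char_poly A = (\<Prod>a\<leftarrow>es. [:- a, 1:])"
    using char_poly_factorized[OF A] by blast
  obtain B P Q where dec: "schur_decomposition A es = (B, P, Q)"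
    by (cases "schur_decomposition A es") auto
  from schur_decomposition[OF A es dec]
  have sim: "similar_mat_wit A B P Q" and ut: "upper_triangular B" and diag: "diag_mat B = es"
    by auto
  note w = similar_mat_witD2[OF A sim]
  have "A * P = P * B * (Q * P)"
    using w by (simp add: assoc_mult_mat[of _ n n _ n _ n])
  then have "A * P = P * B"
    using w by simp
  moreover have "eigenvalue A (B $$ (i, i))" if "i < n" for i
  proof -
    have "B $$ (i, i) \<in> set es"
      using that w(5) unfolding diag[symmetric] diag_mat_def by auto
    then show ?thesis
      unfolding eigenvalue_root_char_poly[OF A] es by (rule linear_poly_root)
  qed
  ultimately show ?thesis
    using that w ut by blast
qed

lemma mat_sum_upd: "mat_sum n (E(t := F)) t = mat_sum n E t"
  by (rule mat_sum_cong) simp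

text \<open>\<open>schur_decomposition\<close> gives no orthogonality of the columns of \<open>P\<close>, so they are
  orthogonalised here: if \<open>S\<close> is the sum of the projections found so far, its complement \<open>I - S\<close>
  kills the earlier columns of \<open>P\<close> and commutes with \<open>A\<close>, and so maps the next column to an
  eigenvector of \<open>A\<close> (or to \<open>0\<close>).\<close>

lemma hermitian_spectral_resolution:
  assumes A: "A \<in> carrier_mat n n" "hermitian A"
  obtains E l where "\<And>i. i < n \<Longrightarrow> E i \<in> carrier_mat n n"
    "\<And>i. i < n \<Longrightarrow> positive_semidefinite (E i)"
    "\<And>i. i < n \<Longrightarrow> l i \<in> spectrum A"
    "\<And>i. i < n \<Longrightarrow> A * E i = l i \<cdot>\<^sub>m E i"
    "mat_sum n E n = 1\<^sub>m n"
proof -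
  obtain B P Q where B: "B \<in> carrier_mat n n" and P: "P \<in> carrier_mat n n"
    and Q: "Q \<in> carrier_mat n n" and PQ: "P * Q = 1\<^sub>m n" and AP: "A * P = P * B"
    and ut: "upper_triangular B" and ev: "\<And>i. i < n \<Longrightarrow> eigenvalue A (B $$ (i, i))"
    using complex_schur_triangularization[OF A(1)] by blast
  define l where "l i = B $$ (i, i)" for i
  define resolution where "resolution E t \<longleftrightarrow>
    (\<forall>i<t. E i \<in> carrier_mat n n \<and> positive_semidefinite (E i) \<and> A * E i = l i \<cdot>\<^sub>m E i)" for E t
  \<comment> \<open>Invariant: \<open>S\<close> is an orthogonal projection that commutes with
    \<open>A\<close> and fixes the columns of \<open>P\<close> before column
    \<open>t\<close>.\<close>
  have "\<exists>E. resolution E t \<and>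
      (let S = mat_sum n E t in
        hermitian S \<and> S * S = S \<and> S * A = A * S \<and> (\<forall>j<t. col (P - S * P) j = 0\<^sub>v n))"
    if "t \<le> n" for t
    using that
  proof (induction t)
    case 0
    have "hermitian (0\<^sub>m n n)" by (rule hermitianI[of _ n]) auto
    then show ?case using A by (auto simp: resolution_def)
  next
    case (Suc t)
    then have t: "t < n" by simp
    obtain E where res: "resolution E t" and E:
      "let S = mat_sum n E t in
        hermitian S \<and> S * S = S \<and> S * A = A * S \<and> (\<forall>j<t. col (P - S * P) j = 0\<^sub>v n)"
      using Suc by auto
    define S where "S = mat_sum n E t"
    have S: "S \<in> carrier_mat n n"
      using res unfolding S_def resolution_def by (intro mat_sum_carrier) auto
    have hS: "hermitian S" and SS: "S * S = S" and SA: "S * A = A * S"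
      and cols: "\<And>j. j < t \<Longrightarrow> col (P - S * P) j = 0\<^sub>v n"
      using E by (auto simp: S_def Let_def)
    \<comment> \<open>\<open>D\<close> is \<open>(I - S) P\<close>, and \<open>w\<close> is what
      remains of column \<open>t\<close> of \<open>P\<close> once its component in the range of
      \<open>S\<close> is removed.\<close>
    define D where "D = P - S * P"
    have D: "D \<in> carrier_mat n n" using P S by (auto simp: D_def)
    define w where "w = col D t"
    have w: "w \<in> carrier_vec n" using D by (auto simp: w_def)
    define F where "F = projection w"
    have F: "F \<in> carrier_mat n n" using projection_carrier[OF w] by (simp add: F_def)
    have psdF: "positive_semidefinite F" using positive_semidefinite_projection[OF w] by (simp add: F_def)
    then have hF: "hermitian F" by (simp add: positive_semidefinite_def)
    have D0: "D $$ (i, j) = 0" if "i < n" "j < t" for i j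
    proof -
      have "D $$ (i, j) = col D j $ i" using that t D by simp
      also have "\<dots> = 0" using cols[OF that(2)] that by (simp add: D_def)
      finally show ?thesis .
    qed
    \<comment> \<open>Since \<open>S\<close> commutes with \<open>A\<close>, the triangular relation
      \<open>A * P = P * B\<close> passes to \<open>D\<close>.\<close>
    have AD: "A * D = D * B"
    proof -
      have "A * D = A * P - A * (S * P)"
        unfolding D_def using A P S by (intro mult_minus_distrib_mat[of _ n n _ n]) auto
      also have "A * (S * P) = S * (A * P)"
        using assoc_mult_mat[OF A(1) S P] assoc_mult_mat[OF S A(1) P] SA by simp
      also have "A * P - S * (A * P) = P * B - S * P * B"
        unfolding AP using B P S by (simp add: assoc_mult_mat[of _ n n _ n _ n])
      also have "\<dots> = D * B"
        unfolding D_def using B P S by (intro minus_mult_distrib_mat[symmetric, of _ n n _ _ n]) auto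
      finally show ?thesis .
    qed
    \<comment> \<open>In column \<open>t\<close> of \<open>D * B\<close> the terms with
      \<open>j < t\<close> vanish because those columns of \<open>D\<close> are zero, and the terms
      with \<open>j > t\<close> because \<open>B\<close> is upper triangular. Only the diagonal
      entry survives.\<close>
    have Aw: "A *\<^sub>v w = l t \<cdot>\<^sub>v w"
    proof (rule eq_vecI)
      fix i assume "i < dim_vec (l t \<cdot>\<^sub>v w)"
      then have i: "i < n" using w by simp
      have "A *\<^sub>v w = col (A * D) t"
        unfolding w_def using A D t by (intro eq_vecI) auto
      then have "(A *\<^sub>v w) $ i = (D * B) $$ (i, t)"
        unfolding AD using i t D B by simp
      also have "\<dots> = (\<Sum>j<n. D $$ (i, j) * B $$ (j, t))"
        using D B i t by (auto simp: scalar_prod_def lessThan_atLeast0)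
      also have "\<dots> = (\<Sum>j\<in>{t}. D $$ (i, j) * B $$ (j, t))"
      proof (rule sum.mono_neutral_right)
        show "\<forall>j\<in>{..<n} - {t}. D $$ (i, j) * B $$ (j, t) = 0"
        proof
          fix j assume "j \<in> {..<n} - {t}"
          then consider "j < t" | "t < j" "j < n" by force
          then show "D $$ (i, j) * B $$ (j, t) = 0"
            using D0[OF i] upper_triangularD[OF ut, of t j] B by cases auto
        qed
      qed (use t in auto)
      finally show "(A *\<^sub>v w) $ i = (l t \<cdot>\<^sub>v w) $ i"
        using i t D by (simp add: l_def w_def mult.commute)
    qed (use A w in auto)
    have AF: "A * F = l t \<cdot>\<^sub>m F"
      unfolding F_def by (rule mult_projection_eigenvector[OF A(1) w Aw])
    have real: "cnj (l t) = l t"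
      unfolding l_def by (rule hermitian_eigenvalue_real[OF A ev[OF t]])
    \<comment> \<open>A real multiple of the Hermitian \<open>F\<close> is Hermitian, which is what
      makes \<open>F\<close> commute with \<open>A\<close>.\<close>
    have "hermitian (A * F)"
      unfolding AF using F hF real
      by (intro hermitianI[of _ n]) (auto simp: hermitianD[of F n])
    then have FA: "F * A = A * F"
      by (rule hermitian_mult_commute[OF A F hF])
    \<comment> \<open>Idempotence of \<open>S\<close> gives this; hence \<open>S\<close> kills
      \<open>w\<close>, and the new projection \<open>F\<close> is orthogonal to
      \<open>S\<close>.\<close>
    have SD: "S * D = 0\<^sub>m n n"
    proof -
      have "S * D = S * P - S * (S * P)"
        unfolding D_def using P S by (intro mult_minus_distrib_mat[of _ n n _ n]) auto
      also have "S * (S * P) = S * P"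
        using assoc_mult_mat[OF S S P] SS by simp
      finally show ?thesis using P S by auto
    qed
    have SF: "S * F = 0\<^sub>m n n"
    proof -
      have "S *\<^sub>v w = col (S * D) t"
        unfolding w_def using S D t by (intro eq_vecI) auto
      also have "\<dots> = 0 \<cdot>\<^sub>v w"
        unfolding SD using w t by (intro eq_vecI) auto
      finally have "S * F = 0 \<cdot>\<^sub>m F"
        unfolding F_def by (rule mult_projection_eigenvector[OF S w])
      then show ?thesis using F by auto
    qed
    have "hermitian (S * F)"
      unfolding SF by (rule hermitianI[of _ n]) auto
    then have FS: "F * S = 0\<^sub>m n n"
      using hermitian_mult_commute[OF S hS F hF] SF by simp
    have "F * F = 1 \<cdot>\<^sub>m F"
      unfolding F_def using w projection_idem[OF w]
      by (intro mult_projection_eigenvector[OF projection_carrier[OF w] w]) auto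
    then have FF: "F * F = F" using F by auto
    define S' where "S' = S + F"
    have S': "S' \<in> carrier_mat n n" using S F by (simp add: S'_def)
    have "S' * S' = S * S' + F * S'"
      unfolding S'_def using S F by (intro add_mult_distrib_mat[of _ n n _ _ n]) auto
    also have "S * S' = S * S + S * F"
      unfolding S'_def using S F by (intro mult_add_distrib_mat[of _ n n _ n]) auto
    also have "F * S' = F * S + F * F"
      unfolding S'_def using S F by (intro mult_add_distrib_mat[of _ n n _ n]) auto
    finally have S'S': "S' * S' = S'"
      using S F by (simp add: SS SF FS FF S'_def)
    have "S' * A = S * A + F * A"
      unfolding S'_def using S F A by (intro add_mult_distrib_mat[of _ n n _ _ n]) auto
    also have "\<dots> = A * S + A * F" by (simp only: SA FA)
    also have "\<dots> = A * S'"
      unfolding S'_def using S F A by (intro mult_add_distrib_mat[symmetric, of _ n n _ n]) auto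
    finally have S'A: "S' * A = A * S'" .
    have hS': "hermitian S'"
      using S F hS hF unfolding S'_def
      by (intro hermitianI[of _ n]) (auto simp: hermitianD[of _ n])
    \<comment> \<open>As \<open>F * S = 0\<close>, the products \<open>F * D\<close> and
      \<open>F * P\<close> agree.\<close>
    have D': "P - S' * P = D - F * D"
    proof -
      have "F * D = F * P - F * (S * P)"
        unfolding D_def using P S F by (intro mult_minus_distrib_mat[of _ n n _ n]) auto
      also have "F * (S * P) = F * S * P"
        using F S P by (simp add: assoc_mult_mat[of _ n n _ n _ n])
      also have "F * P - F * S * P = F * P"
        unfolding FS using F P by auto
      finally have "D - F * D = P - S * P - F * P" by (simp add: D_def)
      also have "\<dots> = P - (S * P + F * P)"
        using P S F by (intro eq_matI) auto
      also have "S * P + F * P = S' * P"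
        unfolding S'_def using S F P by (intro add_mult_distrib_mat[symmetric, of _ n n _ _ n]) auto
      finally show ?thesis by simp
    qed
    \<comment> \<open>Column \<open>t\<close> becomes \<open>w - F w = 0\<close>; the earlier
      columns of \<open>D\<close> are already zero.\<close>
    have cols': "col (P - S' * P) j = 0\<^sub>v n" if "j < Suc t" for j
    proof -
      have j: "j < n" using that t by simp
      have "col (P - S' * P) j = col D j - F *\<^sub>v col D j"
        unfolding D' using D F j by (intro eq_vecI) auto
      also have "\<dots> = 0\<^sub>v n"
      proof (cases "j = t")
        case True
        then show ?thesis
          using projection_idem[OF w] w by (simp add: w_def F_def)
      next
        case False
        then have "col D j = 0\<^sub>v n" using that cols[of j] by (simp add: D_def)
        then show ?thesis using F by (intro eq_vecI) auto
      qed
      finally show ?thesis .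
    qed
    define E' where "E' = E(t := F)"
    have "mat_sum n E' (Suc t) = S'"
      by (simp add: E'_def mat_sum_upd S'_def S_def)
    moreover have "resolution E' (Suc t)"
      using res F psdF AF by (auto simp: resolution_def E'_def less_Suc_eq)
    ultimately show ?case
      using hS' S'S' S'A cols' by (intro exI[of _ E']) (simp add: Let_def)
  qed
  from this[of n] obtain E where res: "resolution E n" and
    cols: "\<And>j. j < n \<Longrightarrow> col (P - mat_sum n E n * P) j = 0\<^sub>v n"
    by (auto simp: Let_def)
  define S where "S = mat_sum n E n"
  have S: "S \<in> carrier_mat n n"
    using res unfolding S_def resolution_def by (intro mat_sum_carrier) auto
  \<comment> \<open>Now \<open>S\<close> fixes every column of \<open>P\<close>; cancelling
    \<open>P\<close> by its right inverse \<open>Q\<close> gives \<open>S = I\<close>.\<close>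
  have "P = S * P"
  proof (rule eq_matI)
    fix i j assume "i < dim_row (S * P)" "j < dim_col (S * P)"
    then have ij: "i < n" "j < n" using S P by auto
    have "col (P - S * P) j $ i = 0" using cols[OF ij(2)] ij by (simp add: S_def)
    then show "P $$ (i, j) = (S * P) $$ (i, j)" using ij S P by simp
  qed (use S P in auto)
  then have "1\<^sub>m n = S * P * Q" using PQ by simp
  also have "\<dots> = S" using S P Q PQ by simp
  finally have "mat_sum n E n = 1\<^sub>m n" by (simp add: S_def)
  moreover have "l i \<in> spectrum A" if "i < n" for i
    using ev[OF that] by (simp add: spectrum_def l_def)
  ultimately show ?thesis
    using that[of E l] res by (auto simp: resolution_def)
qed

section \<open>Block matrices and their positivity\<close>

lemma block_matrix_carrier [simp]: "block_matrix p k X \<in> carrier_mat (p * k) (p * k)"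
  by (simp add: block_matrix_def)

lemma block_matrix_index:
  "a < p * k \<Longrightarrow> b < p * k \<Longrightarrow>
    block_matrix p k X $$ (a, b) = X (a div k + 1) (b div k + 1) $$ (a mod k, b mod k)"
  by (simp add: block_matrix_def)

text \<open>Block numbers have the form \<open>a div k + 1\<close>, so index \<open>0\<close> never
  occurs. The restriction matters later: the rewriting of the exponent with the truncated
  \<open>i - 1\<close> fails at \<open>i = 0\<close>.\<close>

lemma block_matrix_cong:
  assumes "\<And>i j. 1 \<le> i \<Longrightarrow> 1 \<le> j \<Longrightarrow> X i j = Y i j"
  shows "block_matrix p k X = block_matrix p k Y"
  using assms by (simp add: block_matrix_def)

lemma block_matrix_mat_sum:
  assumes "\<And>s i j. s < t \<Longrightarrow> Y s i j \<in> carrier_mat k k"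
  shows "block_matrix p k (\<lambda>i j. mat_sum k (\<lambda>s. Y s i j) t) =
    mat_sum (p * k) (\<lambda>s. block_matrix p k (Y s)) t"
proof -
  have carr: "mat_sum (p * k) (\<lambda>s. block_matrix p k (Y s)) t \<in> carrier_mat (p * k) (p * k)"
    by (rule mat_sum_carrier) simp
  show ?thesis
  proof (rule eq_matI)
    fix a b
    assume "a < dim_row (mat_sum (p * k) (\<lambda>s. block_matrix p k (Y s)) t)"
      "b < dim_col (mat_sum (p * k) (\<lambda>s. block_matrix p k (Y s)) t)"
    then have ab: "a < p * k" "b < p * k" using carr by auto
    then have "0 < k" by (cases k) auto
    then have md: "a mod k < k" "b mod k < k" by simp_all
    show "block_matrix p k (\<lambda>i j. mat_sum k (\<lambda>s. Y s i j) t) $$ (a, b) =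
      mat_sum (p * k) (\<lambda>s. block_matrix p k (Y s)) t $$ (a, b)"
      using assms ab md
      by (simp add: block_matrix_index mat_sum_index)
  qed (use carr in \<open>auto simp: block_matrix_def\<close>)
qed

text \<open>Indices \<open>b\<close> are grouped by \<open>b mod k\<close>, their position inside a
  block; each \<open>b\<close> lies in exactly one group. The form of the block matrix is collapsed
  to \<open>k\<close> dimensions by using this once in each argument.\<close>

lemma sum_mult_fibres_mod:
  fixes h c :: "nat \<Rightarrow> complex"
  assumes "0 < k"
  shows "(\<Sum>x<k. h x * (\<Sum>b<N. if b mod k = x then c b else 0)) = (\<Sum>b<N. h (b mod k) * c b)"
proof -
  have "(\<Sum>x<k. h x * (\<Sum>b<N. if b mod k = x then c b else 0)) =
      (\<Sum>x<k. \<Sum>b<N. if b mod k = x then h x * c b else 0)"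
    unfolding sum_distrib_left by (intro sum.cong refl) simp
  also have "\<dots> = (\<Sum>b<N. \<Sum>x<k. if b mod k = x then h x * c b else 0)"
    by (rule sum.swap)
  also have "\<dots> = (\<Sum>b<N. h (b mod k) * c b)"
    using assms by (intro sum.cong refl) (simp add: sum.delta')
  finally show ?thesis .
qed

text \<open>The block matrix is \<open>L\<^sup>* G L\<close> for the row \<open>L = [y 1 I, \<dots>, y p I]\<close>, so its quadratic form at
  \<open>v\<close> is that of \<open>G\<close> at \<open>u = L v\<close>.\<close>

lemma positive_semidefinite_block_matrix_smult:
  assumes G: "G \<in> carrier_mat k k" "positive_semidefinite G"
  shows "positive_semidefinite
    (block_matrix p k (\<lambda>i j. complex_of_real (y i * y j) \<cdot>\<^sub>m G))" (is "positive_semidefinite ?B")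
proof -
  define z where "z a = complex_of_real (y (a div k + 1))" for a
  have B: "?B $$ (a, b) = z a * z b * G $$ (a mod k, b mod k)" if "a < p * k" "b < p * k" for a b
  proof -
    have "0 < k" using that by (cases k) auto
    then have "a mod k < k" "b mod k < k" by simp_all
    then show ?thesis using that G by (simp add: block_matrix_index z_def)
  qed
  have "hermitian ?B"
  proof (rule hermitianI[of _ "p * k"])
    fix a b assume ab: "a < p * k" "b < p * k"
    then have "0 < k" by (cases k) auto
    then have "cnj (G $$ (b mod k, a mod k)) = G $$ (a mod k, b mod k)"
      using G by (intro hermitianD[of G k]) (auto simp: positive_semidefinite_def)
    then show "cnj (?B $$ (b, a)) = ?B $$ (a, b)"
      unfolding B[OF ab] B[OF ab(2,1)] by (simp add: z_def)
  qed simp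
  moreover have "0 \<le> (?B *\<^sub>v v) \<bullet>c v" if v: "v \<in> carrier_vec (p * k)" for v
  \<comment> \<open>For \<open>k = 0\<close> all vectors are empty and the form is \<open>0\<close>;
    otherwise residues modulo \<open>k\<close> lie below \<open>k\<close>.\<close>
  proof (cases "k = 0")
    case True
    then have v0: "v \<in> carrier_vec 0" using v by simp
    have "?B *\<^sub>v v \<in> carrier_vec 0"
      using mult_mat_vec_carrier[OF block_matrix_carrier v] unfolding True by simp
    from inner_eq_sum[OF this v0] show ?thesis by simp
  next
    case False
    then have k: "0 < k" by simp
    define c where "c b = z b * v $ b" for b
    \<comment> \<open>This is \<open>L v\<close>: component \<open>x\<close> adds up the entries of
      \<open>v\<close> at position \<open>x\<close> of every block, weighted by the \<open>y\<close>
      of the block.\<close>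
    define u where "u = vec k (\<lambda>x. \<Sum>b<p * k. if b mod k = x then c b else 0)"
    have u: "u \<in> carrier_vec k" by (simp add: u_def)
    have Gu: "(G *\<^sub>v u) $ x = (\<Sum>b<p * k. G $$ (x, b mod k) * c b)" if "x < k" for x
      unfolding mult_mat_vec_index_sum[OF G(1) u that]
      using sum_mult_fibres_mod[OF k, of "\<lambda>x'. G $$ (x, x')" c "p * k"] by (simp add: u_def)
    have cu: "cnj (u $ x) = (\<Sum>a<p * k. if a mod k = x then cnj (c a) else 0)" if "x < k" for x
      using that by (simp add: u_def if_distrib cong: if_cong)
    have "(G *\<^sub>v u) \<bullet>c u =
        (\<Sum>x<k. (G *\<^sub>v u) $ x * (\<Sum>a<p * k. if a mod k = x then cnj (c a) else 0))"
      using G u by (simp add: inner_eq_sum[of _ k] cu del: index_mult_mat_vec)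
    also have "\<dots> = (\<Sum>a<p * k. (G *\<^sub>v u) $ (a mod k) * cnj (c a))"
      by (rule sum_mult_fibres_mod[OF k])
    also have "\<dots> = (\<Sum>a<p * k. (\<Sum>b<p * k. G $$ (a mod k, b mod k) * c b) * cnj (c a))"
      using k by (simp add: Gu del: index_mult_mat_vec)
    also have "\<dots> = (\<Sum>a<p * k. (\<Sum>b<p * k. ?B $$ (a, b) * v $ b) * cnj (v $ a))"
      unfolding sum_distrib_right
      by (intro sum.cong refl) (simp add: B c_def z_def del: of_real_mult)
    also have "\<dots> = (\<Sum>a<p * k. (?B *\<^sub>v v) $ a * cnj (v $ a))"
      by (intro sum.cong refl)
        (simp add: mult_mat_vec_index_sum[OF block_matrix_carrier v] del: index_mult_mat_vec)
    also have "\<dots> = (?B *\<^sub>v v) \<bullet>c v"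
      by (rule inner_eq_sum[symmetric]) (use v in \<open>auto intro: mult_mat_vec_carrier[OF block_matrix_carrier]\<close>)
    finally show ?thesis
      using G u by (auto simp: positive_semidefinite_def)
  qed
  ultimately show ?thesis
    by (simp add: positive_semidefinite_def block_matrix_def)
qed

section \<open>Linear maps between matrix spaces\<close>

lemma mat_linear_mapD:
  assumes "mat_linear_map n k \<Phi>"
  shows "X \<in> carrier_mat n n \<Longrightarrow> \<Phi> X \<in> carrier_mat k k"
    and "X \<in> carrier_mat n n \<Longrightarrow> Y \<in> carrier_mat n n \<Longrightarrow> \<Phi> (X + Y) = \<Phi> X + \<Phi> Y"
    and "X \<in> carrier_mat n n \<Longrightarrow> \<Phi> (c \<cdot>\<^sub>m X) = c \<cdot>\<^sub>m \<Phi> X"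
proof -
  interpret linear_map class_ring "module_mat TYPE(complex) n n" "module_mat TYPE(complex) k k" \<Phi>
    using assms by (simp add: mat_linear_map_def)
  show "X \<in> carrier_mat n n \<Longrightarrow> \<Phi> X \<in> carrier_mat k k"
    using T_hom by (auto simp: module_hom_def matrix_vs_simps)
  show "X \<in> carrier_mat n n \<Longrightarrow> Y \<in> carrier_mat n n \<Longrightarrow> \<Phi> (X + Y) = \<Phi> X + \<Phi> Y"
    using T_hom by (auto simp: module_hom_def matrix_vs_simps)
  show "X \<in> carrier_mat n n \<Longrightarrow> \<Phi> (c \<cdot>\<^sub>m X) = c \<cdot>\<^sub>m \<Phi> X"
    using T_hom by (auto simp: module_hom_def matrix_vs_simps)
qed

lemma mat_linear_map_mat_sum:
  assumes "mat_linear_map n k \<Phi>" "\<And>i. i < t \<Longrightarrow> E i \<in> carrier_mat n n"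
  shows "\<Phi> (mat_sum n E t) = mat_sum k (\<lambda>i. \<Phi> (E i)) t"
  using assms(2)
proof (induction t)
  case 0
  \<comment> \<open>Homogeneity with scalar \<open>0\<close> yields the value at the zero
    matrix.\<close>
  have "\<Phi> (0 \<cdot>\<^sub>m 0\<^sub>m n n) = 0 \<cdot>\<^sub>m \<Phi> (0\<^sub>m n n)"
    by (rule mat_linear_mapD(3)[OF assms(1)]) simp
  moreover have "0 \<cdot>\<^sub>m \<Phi> (0\<^sub>m n n) = 0\<^sub>m k k"
    using mat_linear_mapD(1)[OF assms(1), of "0\<^sub>m n n"] by (intro eq_matI) auto
  ultimately show ?case by simp
next
  case (Suc t)
  have "mat_sum n E t \<in> carrier_mat n n" "E t \<in> carrier_mat n n"
    using Suc.prems by (auto intro: mat_sum_carrier)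
  then show ?case
    using mat_linear_mapD(2)[OF assms(1)] Suc by simp
qed

section \<open>Integer powers of a positive definite matrix on eigenspaces\<close>

lemma smult_smult_mat: "a \<cdot>\<^sub>m (b \<cdot>\<^sub>m A) = (a * b :: complex) \<cdot>\<^sub>m A"
  by (intro eq_matI) auto

lemma pow_mat_mult_eigen:
  assumes A: "A \<in> carrier_mat n n" and E: "E \<in> carrier_mat n n"
    and ev: "A * E = (l :: complex) \<cdot>\<^sub>m E"
  shows "(A ^\<^sub>m p) * E = l ^ p \<cdot>\<^sub>m E"
proof (induction p)
  case 0
  then show ?case using A E by auto
next
  case (Suc p)
  have Ap: "A ^\<^sub>m p \<in> carrier_mat n n" using A by simp
  have "A ^\<^sub>m Suc p * E = A ^\<^sub>m p * (A * E)"
    using assoc_mult_mat[OF Ap A E] by simp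
  also have "\<dots> = l \<cdot>\<^sub>m (A ^\<^sub>m p * E)"
    unfolding ev using Ap E by (rule mult_smult_distrib)
  also have "\<dots> = l ^ Suc p \<cdot>\<^sub>m E"
    unfolding Suc by (intro eq_matI) auto
  finally show ?case .
qed

text \<open>A zero determinant would give a nonzero kernel vector, at which the form vanishes. Hence
  \<open>the (mat_inverse A)\<close> in \<open>mat_powi\<close> is a genuine inverse.\<close>

lemma positive_definite_mat_inverse:
  assumes A: "A \<in> carrier_mat n n" and pd: "positive_definite A"
  obtains C where "mat_inverse A = Some C" "C \<in> carrier_mat n n" "C * A = 1\<^sub>m n"
proof -
  have "det A \<noteq> 0"
  proof
    assume "det A = 0"
    then obtain v where v: "v \<in> carrier_vec n" "v \<noteq> 0\<^sub>v n" "A *\<^sub>v v = 0\<^sub>v n"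
      using det_0_iff_vec_prod_zero_field[OF A] by blast
    then have "0 < (A *\<^sub>v v) \<bullet>c v"
      using pd A by (auto simp: positive_definite_def)
    then show False using v by simp
  qed
  then have "A \<in> Units (ring_mat TYPE(complex) n undefined)"
    by (rule det_non_zero_imp_unit[OF A])
  then obtain C where "mat_inverse A = Some C"
    using mat_inverse(1)[OF A] by fastforce
  then show ?thesis
    using mat_inverse(2)[OF A] that by blast
qed

text \<open>At an eigenvector the positive form is \<open>x\<close> times the nonnegative
  \<open>v \<bullet>c v\<close>.\<close>

lemma positive_definite_eigenvalue_pos:
  assumes A: "A \<in> carrier_mat n n" "positive_definite A" and l: "eigenvalue A (complex_of_real x)"
  shows "0 < x"
proof -
  obtain v where v: "v \<in> carrier_vec n" "v \<noteq> 0\<^sub>v n" and ev: "A *\<^sub>v v = complex_of_real x \<cdot>\<^sub>v v"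
    using l A(1) by (auto simp: eigenvalue_def eigenvector_def)
  have "0 < (A *\<^sub>v v) \<bullet>c v"
    using A v by (auto simp: positive_definite_def)
  also have "(A *\<^sub>v v) \<bullet>c v = complex_of_real x * (v \<bullet>c v)"
    using v unfolding ev by (auto intro!: smult_scalar_prod_distrib[of _ n])
  finally have "0 < x * Re (v \<bullet>c v)"
    by (simp add: less_complex_def)
  moreover have "0 \<le> Re (v \<bullet>c v)"
    using conjugate_square_ge_0_vec[of v] by (simp add: less_eq_complex_def)
  ultimately show ?thesis
    by (simp add: zero_less_mult_iff)
qed

text \<open>Applying the inverse \<open>C\<close> to \<open>A * E = l E\<close> gives
  \<open>C * E = inverse l E\<close>, so both signs of the exponent reduce to natural powers, of
  \<open>A\<close> or of \<open>C\<close>.\<close>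

lemma mat_powi_mult_eigen:
  assumes A: "A \<in> carrier_mat n n" "positive_definite A" and E: "E \<in> carrier_mat n n"
    and ev: "A * E = l \<cdot>\<^sub>m E" and l: "l \<noteq> 0"
  shows "mat_powi A e * E = l powi e \<cdot>\<^sub>m E"
proof -
  obtain C where C: "mat_inverse A = Some C" "C \<in> carrier_mat n n" "C * A = 1\<^sub>m n"
    using positive_definite_mat_inverse[OF A] .
  have "E = C * (A * E)"
    using assoc_mult_mat[OF C(2) A(1) E] C E by simp
  also have "\<dots> = l \<cdot>\<^sub>m (C * E)"
    unfolding ev using C(2) E by (rule mult_smult_distrib)
  finally have "inverse l \<cdot>\<^sub>m E = inverse l \<cdot>\<^sub>m (l \<cdot>\<^sub>m (C * E))" by simp
  moreover have "1 \<cdot>\<^sub>m (C * E) = C * E" by (intro eq_matI) auto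
  ultimately have "C * E = inverse l \<cdot>\<^sub>m E"
    using l by (simp add: smult_smult_mat)
  then show ?thesis
    using pow_mat_mult_eigen[OF A(1) E ev] pow_mat_mult_eigen[OF C(2) E]
    by (simp add: mat_powi_def C(1) power_int_def)
qed

lemma mat_powi_carrier:
  assumes "A \<in> carrier_mat n n" "positive_definite A"
  shows "mat_powi A e \<in> carrier_mat n n"
proof -
  obtain C where "mat_inverse A = Some C" "C \<in> carrier_mat n n"
    using positive_definite_mat_inverse[OF assms] .
  then show ?thesis using assms(1) by (simp add: mat_powi_def)
qed

section \<open>Reduction of the block matrix to scalars on the spectral resolution\<close>

theorem theorem2p5:
  fixes n k r :: nat
    and \<Phi> :: "complex mat \<Rightarrow> complex mat"
    and A :: "complex mat"
    and m M :: real
  assumes "mat_linear_map n k \<Phi>"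
    and "positive_map n \<Phi>"
    and "unital_map n k \<Phi>"
    and "A \<in> carrier_mat n n"
    and "hermitian A"
    and "spectrum A \<subseteq> complex_of_real ` {m..M}"
    and "positive_definite A"
  shows "positive_semidefinite
    (block_matrix (r + 1) k
      (\<lambda>i j. \<Phi> (mat_powi A (int i + int j - 3)
                * (A - complex_of_real m \<cdot>\<^sub>m 1\<^sub>m n)
                * (complex_of_real M \<cdot>\<^sub>m 1\<^sub>m n - A))))"
proof -
  note lin = assms(1) and A = assms(4)
  obtain E l where E: "\<And>s. s < n \<Longrightarrow> E s \<in> carrier_mat n n"
    and psd: "\<And>s. s < n \<Longrightarrow> positive_semidefinite (E s)"
    and spec: "\<And>s. s < n \<Longrightarrow> l s \<in> spectrum A"
    and ev: "\<And>s. s < n \<Longrightarrow> A * E s = l s \<cdot>\<^sub>m E s"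
    and sum: "mat_sum n E n = 1\<^sub>m n"
    using hermitian_spectral_resolution[OF A assms(5)] by blast
  define x where "x s = Re (l s)" for s
  \<comment> \<open>The inclusion of the spectrum makes the eigenvalues real and bounds them;
    positive definiteness makes them positive.\<close>
  have l: "l s = complex_of_real (x s)" and x: "m \<le> x s" "x s \<le> M" "0 < x s" if "s < n" for s
  proof -
    show lx: "l s = complex_of_real (x s)" and "m \<le> x s" "x s \<le> M"
      using spec[OF that] assms(6) by (auto simp: x_def)
    show "0 < x s"
      using positive_definite_eigenvalue_pos[OF A assms(7)] spec[OF that] lx
      by (simp add: spectrum_def)
  qed
  \<comment> \<open>The exponent splits as \<open>(i - 1) + (j - 1) - 1\<close>: the first two parts
    go into \<open>y\<close>, the last one is the divisor in \<open>c\<close>.\<close>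
  define c where "c s = (x s - m) * (M - x s) / x s" for s
  define G where "G s = complex_of_real (c s) \<cdot>\<^sub>m \<Phi> (E s)" for s
  define y where "y s i = x s ^ (i - 1)" for s i
  let ?U = "A - complex_of_real m \<cdot>\<^sub>m 1\<^sub>m n" and ?V = "complex_of_real M \<cdot>\<^sub>m 1\<^sub>m n - A"
  have UV: "?U \<in> carrier_mat n n" "?V \<in> carrier_mat n n" using A by auto
  have G: "G s \<in> carrier_mat k k" "positive_semidefinite (G s)" if "s < n" for s
  proof -
    have "\<Phi> (E s) \<in> carrier_mat k k" by (rule mat_linear_mapD(1)[OF lin E[OF that]])
    moreover have "positive_semidefinite (\<Phi> (E s))"
      using assms(2) E[OF that] psd[OF that] by (simp add: positive_map_def)
    moreover have "0 \<le> c s" using x[OF that] by (simp add: c_def)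
    ultimately show "G s \<in> carrier_mat k k" "positive_semidefinite (G s)"
      by (auto simp: G_def intro: positive_semidefinite_smult)
  qed
  have "\<Phi> (mat_powi A (int i + int j - 3) * ?U * ?V) =
      mat_sum k (\<lambda>s. complex_of_real (y s i * y s j) \<cdot>\<^sub>m G s) n"
    if ij: "1 \<le> i" "1 \<le> j" for i j
  proof -
    let ?e = "int i + int j - 3"
    let ?X = "mat_powi A ?e * ?U * ?V"
    have W: "mat_powi A ?e \<in> carrier_mat n n" by (rule mat_powi_carrier[OF A assms(7)])
    have X: "?X \<in> carrier_mat n n" using W UV by auto
    have XE: "?X * E s = complex_of_real (y s i * y s j * c s) \<cdot>\<^sub>m E s" if s: "s < n" for s
    proof -
      note Es = E[OF s]
      have V: "?V * E s = complex_of_real (M - x s) \<cdot>\<^sub>m E s"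
      proof -
        have "?V * E s = complex_of_real M \<cdot>\<^sub>m 1\<^sub>m n * E s - A * E s"
          using A Es by (intro minus_mult_distrib_mat[of _ n n _ _ n]) auto
        also have "\<dots> = complex_of_real M \<cdot>\<^sub>m E s - l s \<cdot>\<^sub>m E s"
          using Es ev[OF s] by (simp add: mult_smult_assoc_mat[of _ n n])
        finally show ?thesis
          using Es unfolding l[OF s] by (auto simp: algebra_simps)
      qed
      have U: "?U * E s = complex_of_real (x s - m) \<cdot>\<^sub>m E s"
      proof -
        have "?U * E s = A * E s - complex_of_real m \<cdot>\<^sub>m 1\<^sub>m n * E s"
          using A Es by (intro minus_mult_distrib_mat[of _ n n _ _ n]) auto
        also have "\<dots> = l s \<cdot>\<^sub>m E s - complex_of_real m \<cdot>\<^sub>m E s"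
          using Es ev[OF s] by (simp add: mult_smult_assoc_mat[of _ n n])
        finally show ?thesis
          using Es unfolding l[OF s] by (auto simp: algebra_simps)
      qed
      have "l s \<noteq> 0" using x[OF s] by (simp add: l[OF s])
      note P = mat_powi_mult_eigen[OF A assms(7) Es ev[OF s] this, of ?e]
      \<comment> \<open>The factors act on \<open>E s\<close> from the right one after another, each
        as a scalar.\<close>
      have "?X * E s = mat_powi A ?e * (?U * (?V * E s))"
        using W UV Es by (simp add: assoc_mult_mat[of _ n n _ n _ n])
      also have "\<dots> = (complex_of_real (M - x s) * complex_of_real (x s - m) * l s powi ?e) \<cdot>\<^sub>m E s"
        unfolding V mult_smult_distrib[OF UV(1) Es] U smult_smult_mat
          mult_smult_distrib[OF W Es] P ..
      also have "complex_of_real (M - x s) * complex_of_real (x s - m) * l s powi ?e =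
          complex_of_real ((M - x s) * (x s - m) * x s powi ?e)"
        by (simp add: l[OF s])
      \<comment> \<open>The exponent is \<open>-1\<close> in the corner block
        \<open>i = j = 1\<close>, so splitting the power relies on \<open>x s\<close> being
        nonzero.\<close>
      also have "x s powi ?e = y s i * y s j / x s"
      proof -
        have "x s powi (int a + int b - 1) = x s ^ a * x s ^ b / x s" for a b
          using x(3)[OF s] by (simp add: power_int_diff power_int_add)
        moreover have "?e = int (i - 1) + int (j - 1) - 1" using ij by simp
        ultimately show ?thesis by (simp only: y_def)
      qed
      also have "(M - x s) * (x s - m) * (y s i * y s j / x s) = y s i * y s j * c s"
        by (simp add: c_def)
      finally show ?thesis .
    qed
    \<comment> \<open>Inserting the resolution of the identity on the right expands the matrix into
      multiples of the \<open>E s\<close>, to which linearity of \<open>\<Phi>\<close>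
      applies.\<close>
    have "?X = ?X * mat_sum n E n" unfolding sum by (rule right_mult_one_mat[OF X, symmetric])
    also have "\<dots> = mat_sum n (\<lambda>s. ?X * E s) n" by (rule mult_mat_sum[OF X E])
    also have "\<dots> = mat_sum n (\<lambda>s. complex_of_real (y s i * y s j * c s) \<cdot>\<^sub>m E s) n"
      by (rule mat_sum_cong) (rule XE)
    finally have "\<Phi> ?X = mat_sum k (\<lambda>s. \<Phi> (complex_of_real (y s i * y s j * c s) \<cdot>\<^sub>m E s)) n"
      using E by (simp add: mat_linear_map_mat_sum[OF lin])
    also have "\<dots> = mat_sum k (\<lambda>s. complex_of_real (y s i * y s j) \<cdot>\<^sub>m G s) n"
      by (rule mat_sum_cong) (simp add: mat_linear_mapD(3)[OF lin E] G_def smult_smult_mat)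
    finally show ?thesis .
  qed
  then have "block_matrix (r + 1) k (\<lambda>i j. \<Phi> (mat_powi A (int i + int j - 3) * ?U * ?V)) =
      block_matrix (r + 1) k (\<lambda>i j. mat_sum k (\<lambda>s. complex_of_real (y s i * y s j) \<cdot>\<^sub>m G s) n)"
    by (rule block_matrix_cong)
  also have "\<dots> = mat_sum ((r + 1) * k)
      (\<lambda>s. block_matrix (r + 1) k (\<lambda>i j. complex_of_real (y s i * y s j) \<cdot>\<^sub>m G s)) n"
    using G by (intro block_matrix_mat_sum) auto
  finally show ?thesis
    by (simp only:)
      (intro positive_semidefinite_mat_sum block_matrix_carrier
        positive_semidefinite_block_matrix_smult G)
qed

end
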